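(* Let $p$ be an odd prime, let $m\ge1$ with $2m<p$, and let $y_0,y_1,\dots,y_{2m}$ be integers that are pairwise distinct modulo $p$. Let $P_m$ be the $m$-th Legendre polynomial and let $k^2=\varepsilon$. Then $$\sum_{j=0}^{2m}\left\langle\frac{pu}{[u]_p}\prod_{0\le i\le 2m,\ i\ne j}\frac u{[u]_{y_i-y_j}}\right\rangle_{2m}\equiv k^mP_m\!\left(\frac{\delta}k\right)\pmod{p\,\mathbb Z_p[\delta,\varepsilon]},$$ where $[u]_s$ is the $s$-th power in the formal group law of the elliptic genus and $\langle h(u)\rangle_{2m}$ is the coefficient of $u^{2m}$ in $h(u)$.
   Context: Let $\delta,\varepsilon$ be indeterminates and let $f(x)=x+\cdots$ be the power series over $\mathbb Q[\delta,\varepsilon]$ with $(f')^2=1-2\delta f^2+\varepsilon f^4$, $f(0)=0$. The formal group law of the elliptic genus is $F(u,v)=f(f^{-1}(u)+f^{-1}(v))$, which has coefficients in $\mathbb Z[\frac12][\delta,\varepsilon]$, and $[u]_s=f(s f^{-1}(u))=su+\cdots$ for $s\in\mathbb Z$. Legendre polynomials: $\frac1{\sqrt{1-2\delta u+u^2}}=1+\sum_{m>0}P_m(\delta)u^m$; thus $k^mP_m(\delta/k)$ is a polynomial in $\delta$ and $\varepsilon=k^2$, the coefficient of $u^{2m}$ in $(1-2\delta u^2+\varepsilon u^4)^{-1/2}$. The congruence means that the difference of the two sides, which a priori lies in $\mathbb Q_p[\delta,\varepsilon]$, lies in $p\,\mathbb Z_p[\delta,\varepsilon]$. *)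

theory Defs
  imports "HOL-Computational_Algebra.Computational_Algebra" "HOL-Number_Theory.Cong"
begin

section \<open>Power series over integral domains\<close>

text \<open>The library's \<open>inverse\<close>, \<open>/\<close> and \<open>fps_inv\<close> for formal power series require a coefficient
  field, whereas the coefficients here lie in the ring $\mathbb{Q}[\delta,\varepsilon]$. The quotient
  and the compositional inverse are therefore given by their characteristic properties; the
  lemmas below show that they are uniquely determined wherever they are used.\<close>

definition fps_quot :: "'a::idom fps \<Rightarrow> 'a fps \<Rightarrow> 'a fps" where
  "fps_quot a b = (THE h. h * b = a)"

definition fps_comp_inv :: "'a::idom fps \<Rightarrow> 'a fps" where
  "fps_comp_inv a = (THE b. fps_nth b 0 = 0 \<and> a oo b = fps_X)"

section \<open>The elliptic genus\<close>

text \<open>$\mathbb{Q}[\delta,\varepsilon]$ is \<^typ>\<open>rat poly poly\<close>: the inner variable is $\delta$,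
  the outer one is $\varepsilon$.\<close>

definition ell_delta :: "rat poly poly" where
  "ell_delta = [:[:0, 1:]:]"

definition ell_eps :: "rat poly poly" where
  "ell_eps = [:0, 1:]"

definition ell_f :: "rat poly poly fps" where
  "ell_f = (THE f. fps_nth f 0 = 0 \<and> fps_nth f 1 = 1 \<and>
     fps_deriv f ^ 2 = 1 - 2 * fps_const ell_delta * f ^ 2 + fps_const ell_eps * f ^ 4)"

definition ell_pow :: "int \<Rightarrow> rat poly poly fps" where
  "ell_pow s = ell_f oo (of_int s * fps_comp_inv ell_f)"

section \<open>Legendre polynomials\<close>

definition legendre_series :: "rat poly fps" where
  "legendre_series = (THE L. fps_nth L 0 = 1 \<and>
     L ^ 2 * (1 - 2 * fps_const [:0, 1:] * fps_X + fps_X ^ 2) = 1)"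

definition legendre_poly :: "nat \<Rightarrow> rat poly" where
  "legendre_poly m = fps_nth legendre_series m"

text \<open>\<open>legendre_hom m\<close> is $k^m P_m(\delta/k)$ as a polynomial in $\delta$ and $\varepsilon = k^2$. The
  defining equation lives in the field $\mathbb{Q}(\delta,k)$, the fraction field of
  $\mathbb{Q}[\delta][k]$, into which $\mathbb{Q}[\delta,\varepsilon]$ is mapped by
  $\varepsilon \mapsto k^2$.\<close>

definition rat_to_frac :: "rat \<Rightarrow> rat poly poly fract" where
  "rat_to_frac c = to_fract [:[:c:]:]"

definition frac_delta :: "rat poly poly fract" where
  "frac_delta = to_fract [:[:0, 1:]:]"

definition frac_k :: "rat poly poly fract" where
  "frac_k = to_fract [:0, 1:]"

definition eps_to_k2 :: "rat poly poly \<Rightarrow> rat poly poly fract" where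
  "eps_to_k2 R = to_fract (pcompose R ([:0, 1:] ^ 2))"

definition legendre_hom :: "nat \<Rightarrow> rat poly poly" where
  "legendre_hom m = (THE R. eps_to_k2 R =
     frac_k ^ m * poly (map_poly rat_to_frac (legendre_poly m)) (frac_delta / frac_k))"

section \<open>Congruence modulo $p\mathbb{Z}_p[\delta,\varepsilon]$\<close>

text \<open>All coefficients that occur are rational, so only $\mathbb{Z}_p \cap \mathbb{Q}$ is needed:
  the fractions whose denominator is prime to $p$.\<close>

definition p_integral :: "nat \<Rightarrow> rat \<Rightarrow> bool" where
  "p_integral p q \<longleftrightarrow> (\<exists>a b::int. \<not> int p dvd b \<and> q = of_int a / of_int b)"

definition cong_pZp :: "nat \<Rightarrow> rat poly poly \<Rightarrow> rat poly poly \<Rightarrow> bool" where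
  "cong_pZp p A B \<longleftrightarrow>
     (\<exists>D. (\<forall>i j. p_integral p (coeff (coeff D i) j)) \<and> A - B = of_nat p * D)"

section \<open>The definite descriptions are well defined\<close>

lemma fps_cutoff_rec:
  fixes \<Phi> :: "nat \<Rightarrow> 'a::zero fps \<Rightarrow> 'a"
  shows "\<exists>g. \<forall>n. fps_nth g n = \<Phi> n (fps_cutoff n g)"
proof -
  define h where "h = rec_nat (0 :: 'a fps)
    (\<lambda>n t. Abs_fps (\<lambda>k. if k = n then \<Phi> n t else fps_nth t k))"
  have h_Suc: "h (Suc n) = Abs_fps (\<lambda>k. if k = n then \<Phi> n (h n) else fps_nth (h n) k)" for n
    unfolding h_def by simp
  have h0: "h 0 = 0" by (simp add: h_def)
  have above: "fps_nth (h n) k = 0" if "k \<ge> n" for n k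
    using that by (induction n) (auto simp: h0 h_Suc)
  have stable: "fps_nth (h n) k = fps_nth (h (Suc k)) k" if "k < n" for n k
    using that
  proof (induction n)
    case (Suc n)
    then show ?case by (cases "k = n") (auto simp: h_Suc)
  qed auto
  define g where "g = Abs_fps (\<lambda>n. fps_nth (h (Suc n)) n)"
  have "fps_cutoff n g = h n" for n
  proof (rule fps_ext)
    fix k
    show "fps_nth (fps_cutoff n g) k = fps_nth (h n) k"
    proof (cases "k < n")
      case True
      then show ?thesis using stable[OF True] by (simp only: fps_cutoff_nth g_def fps_nth_Abs_fps if_True)
    next
      case False
      then show ?thesis using above[of n k] by simp
    qed
  qed
  then have "fps_nth g n = \<Phi> n (fps_cutoff n g)" for n
    by (simp add: g_def h_Suc)
  then show ?thesis by blast
qed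

lemma fps_cutoff_split:
  fixes g :: "'a::comm_ring_1 fps"
  shows "g = fps_cutoff n g + fps_X ^ n * fps_shift n g"
  by (intro fps_ext) (auto simp: fps_X_power_mult_nth)

lemma fps_eqI_cutoff:
  fixes g h :: "'a::zero fps"
  assumes "\<And>n. fps_cutoff n g = fps_cutoff n h \<Longrightarrow> fps_nth g n = fps_nth h n"
  shows "g = h"
proof -
  have "fps_nth g n = fps_nth h n" for n
  proof (induction n rule: less_induct)
    case (less n)
    then have "fps_cutoff n g = fps_cutoff n h" by (intro fps_ext) auto
    then show ?case by (rule assms)
  qed
  then show ?thesis by (intro fps_ext)
qed

lemma fps_quot_eqI:
  assumes "h * b = a" "b \<noteq> 0"
  shows "fps_quot a b = h"
  unfolding fps_quot_def using assms by (intro the_equality) auto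

lemma fps_nth_power_cutoff:
  fixes g :: "'a::comm_ring_1 fps"
  assumes "n > 0" "fps_nth g 0 = 0" "i \<noteq> 1"
  shows "fps_nth (g ^ i) n = fps_nth (fps_cutoff n g ^ i) n"
proof (cases "i = 0")
  case False
  define T where "T = fps_cutoff n g"
  have T0: "fps_nth T 0 = 0" using assms by (simp add: T_def)
  define S where "S = (\<Sum>j<i. T ^ (i - Suc j) * g ^ j)"
  have S0: "fps_nth S 0 = 0"
    unfolding S_def fps_sum_nth
  proof (intro sum.neutral ballI)
    fix j assume "j \<in> {..<i}"
    then have "j > 0 \<or> i - Suc j > 0" using assms False by auto
    then show "fps_nth (T ^ (i - Suc j) * g ^ j) 0 = 0"
      using T0 assms(2) by (auto simp: fps_power_zeroth power_0_left)
  qed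
  have gT: "g - T = fps_X ^ n * fps_shift n g"
    using fps_cutoff_split[of g n] by (simp add: T_def algebra_simps)
  have "g ^ i - T ^ i = (g - T) * S"
    unfolding S_def by (rule power_diff_sumr2)
  also have "\<dots> = fps_X ^ n * (fps_shift n g * S)"
    by (simp only: gT mult.assoc)
  finally have "fps_nth (g ^ i - T ^ i) n = 0"
    using S0 by (simp add: fps_X_power_mult_nth)
  then show ?thesis by (simp add: T_def)
qed auto

lemma fps_comp_nth_cutoff:
  fixes f g :: "'a::comm_ring_1 fps"
  assumes "n > 0" "fps_nth g 0 = 0" "fps_nth f 1 = 1"
  shows "fps_nth (f oo g) n = fps_nth (f oo fps_cutoff n g) n + fps_nth g n"
proof -
  have "fps_nth f i * fps_nth (g ^ i) n =
     fps_nth f i * fps_nth (fps_cutoff n g ^ i) n + (if i = 1 then fps_nth g n else 0)" for i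
    using fps_nth_power_cutoff[of n g i] assms by auto
  then show ?thesis
    using assms by (simp add: fps_compose_nth sum.distrib sum.delta)
qed

lemma fps_comp_inv_ex1:
  fixes f :: "'a::idom fps"
  assumes "fps_nth f 0 = 0" "fps_nth f 1 = 1"
  shows "\<exists>!g. fps_nth g 0 = 0 \<and> f oo g = fps_X"
proof -
  define \<Phi> where "\<Phi> = (\<lambda>n T. if n = 0 then 0 else fps_nth fps_X n - fps_nth (f oo T) n)"
  have *: "fps_nth g 0 = 0 \<and> f oo g = fps_X \<longleftrightarrow> (\<forall>n. fps_nth g n = \<Phi> n (fps_cutoff n g))" for g
  proof
    assume g: "fps_nth g 0 = 0 \<and> f oo g = fps_X"
    show "\<forall>n. fps_nth g n = \<Phi> n (fps_cutoff n g)"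
    proof
      fix n
      show "fps_nth g n = \<Phi> n (fps_cutoff n g)"
        using g fps_comp_nth_cutoff[of n g f] assms
        by (cases "n = 0") (auto simp: \<Phi>_def)
    qed
  next
    assume g: "\<forall>n. fps_nth g n = \<Phi> n (fps_cutoff n g)"
    have g0: "fps_nth g 0 = 0" using g[rule_format, of 0] by (simp add: \<Phi>_def)
    have "fps_nth (f oo g) n = fps_nth fps_X n" for n
    proof (cases "n = 0")
      case False
      then show ?thesis
        using fps_comp_nth_cutoff[of n g f] assms g0 g[rule_format, of n] by (simp add: \<Phi>_def)
    qed (use assms in auto)
    then show "fps_nth g 0 = 0 \<and> f oo g = fps_X" using g0 by (auto intro: fps_ext)
  qed
  obtain g where g: "\<forall>n. fps_nth g n = \<Phi> n (fps_cutoff n g)"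
    using fps_cutoff_rec[of \<Phi>] by blast
  show ?thesis
  proof (rule ex1I)
    show "fps_nth g 0 = 0 \<and> f oo g = fps_X" using g * by blast
  next
    fix h assume "fps_nth h 0 = 0 \<and> f oo h = fps_X"
    then have "\<forall>n. fps_nth h n = \<Phi> n (fps_cutoff n h)" using * by blast
    then show "h = g" using g by (intro fps_eqI_cutoff) metis
  qed
qed

lemma fps_comp_inv:
  fixes f :: "'a::idom fps"
  assumes "fps_nth f 0 = 0" "fps_nth f 1 = 1"
  shows "fps_nth (fps_comp_inv f) 0 = 0" "f oo fps_comp_inv f = fps_X"
    "fps_nth (fps_comp_inv f) 1 = 1"
proof -
  show 1: "fps_nth (fps_comp_inv f) 0 = 0" and 2: "f oo fps_comp_inv f = fps_X"
    using theI'[OF fps_comp_inv_ex1[OF assms]] by (simp_all add: fps_comp_inv_def)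
  have "fps_nth (f oo fps_comp_inv f) 1 = 1" using 2 by simp
  then show "fps_nth (fps_comp_inv f) 1 = 1"
    using assms by (simp add: fps_compose_nth)
qed

lemma ell_f_ex1:
  "\<exists>!f. fps_nth f 0 = 0 \<and> fps_nth f 1 = 1 \<and>
     fps_deriv f ^ 2 = 1 - 2 * fps_const ell_delta * f ^ 2 + fps_const ell_eps * f ^ 4"
  (is "\<exists>!f. ?P f")
proof -
  define d e where "d = fps_const ell_delta" and "e = fps_const ell_eps"
  define G where "G = (\<lambda>f. 2 * e * f ^ 3 - 2 * d * f)"
  define r where "r = (\<lambda>n::nat. [:[:1 / of_nat n:]:] :: rat poly poly)"
  have r: "of_nat n * r n = 1" if "n > 0" for n
    using that by (simp add: r_def of_nat_poly one_pCons)
  define \<Phi> where "\<Phi> = (\<lambda>n T. if n = 0 then 0 else if n = 1 then 1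
     else r n * (r (n - 1) * fps_nth (G T) (n - 2)))"
  have Gcut: "fps_nth (G (fps_cutoff (Suc (Suc n)) f)) n = fps_nth (G f) n" for f n
  proof -
    define T where "T = fps_cutoff (Suc (Suc n)) f"
    define S where "S = fps_shift (Suc (Suc n)) f"
    have f: "f = T + fps_X ^ Suc (Suc n) * S"
      unfolding T_def S_def by (rule fps_cutoff_split)
    have "G f - G T = (f - T) * (2 * e * (f ^ 2 + f * T + T ^ 2) - 2 * d)"
      by (simp add: G_def algebra_simps power2_eq_square power3_eq_cube)
    also have "f - T = fps_X ^ Suc (Suc n) * S" using f by simp
    finally have "G f - G T =
        fps_X ^ Suc (Suc n) * (S * (2 * e * (f ^ 2 + f * T + T ^ 2) - 2 * d))"
      by (simp only: mult.assoc)
    then have "fps_nth (G f - G T) n = 0" by (simp only: fps_X_power_mult_nth) simp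
    then show ?thesis by (simp add: T_def)
  qed
  have d1: "fps_deriv d = 0" and e1: "fps_deriv e = 0" by (simp_all add: d_def e_def)
  have two1: "fps_deriv (2 :: rat poly poly fps) = 0"
    using fps_deriv_of_nat[where 'a = "rat poly poly", of 2] by simp
  have DE: "fps_deriv (fps_deriv f ^ 2 - (1 - 2 * d * f ^ 2 + e * f ^ 4)) =
      2 * fps_deriv f * (fps_deriv (fps_deriv f) - G f)" for f
    by (simp add: G_def d1 e1 two1 fps_deriv_power' algebra_simps power2_eq_square
        power3_eq_cube eval_nat_numeral)
  have *: "?P f \<longleftrightarrow> (\<forall>n. fps_nth f n = \<Phi> n (fps_cutoff n f))" for f
  proof
    assume f: "?P f"
    have "2 * fps_deriv f * (fps_deriv (fps_deriv f) - G f) = 0"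
      using DE[of f] f by (simp add: d_def e_def)
    moreover have "fps_nth (fps_deriv f) 0 = 1" using f by simp
    then have "fps_deriv f \<noteq> 0" by (metis fps_zero_nth zero_neq_one)
    ultimately have ode: "fps_deriv (fps_deriv f) = G f" by simp
    show "\<forall>n. fps_nth f n = \<Phi> n (fps_cutoff n f)"
    proof
      fix n
      consider "n = 0" | "n = 1" | k where "n = Suc (Suc k)"
        by (metis One_nat_def not0_implies_Suc)
      then show "fps_nth f n = \<Phi> n (fps_cutoff n f)"
      proof cases
        case 3
        have "fps_nth (G f) k = of_nat (Suc k) * (of_nat n * fps_nth f n)"
          unfolding ode[symmetric] 3 by (simp add: algebra_simps)
        then have "\<Phi> n (fps_cutoff n f) =
            (of_nat n * r n) * (of_nat (Suc k) * r (Suc k)) * fps_nth f n"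
          using Gcut[of k f] 3 by (simp add: \<Phi>_def del: of_nat_Suc)
        also have "\<dots> = fps_nth f n" using r[of n] r[of "Suc k"] 3 by (simp del: of_nat_Suc)
        finally show ?thesis ..
      qed (use f in \<open>auto simp: \<Phi>_def\<close>)
    qed
  next
    assume f: "\<forall>n. fps_nth f n = \<Phi> n (fps_cutoff n f)"
    have f0: "fps_nth f 0 = 0" and f1: "fps_nth f 1 = 1"
      using f[rule_format, of 0] f[rule_format, of 1] by (simp_all add: \<Phi>_def)
    have "fps_deriv (fps_deriv f) = G f"
    proof (rule fps_ext)
      fix k
      have "fps_nth f (Suc (Suc k)) = r (Suc (Suc k)) * (r (Suc k) * fps_nth (G f) k)"
        using f[rule_format, of "Suc (Suc k)"] Gcut[of k f] by (simp add: \<Phi>_def)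
      then have "fps_nth (fps_deriv (fps_deriv f)) k =
          (of_nat (Suc (Suc k)) * r (Suc (Suc k))) * (of_nat (Suc k) * r (Suc k)) * fps_nth (G f) k"
        by (simp del: of_nat_Suc)
      then show "fps_nth (fps_deriv (fps_deriv f)) k = fps_nth (G f) k"
        using r[of "Suc k"] r[of "Suc (Suc k)"] by (simp del: of_nat_Suc)
    qed
    then have "fps_deriv (fps_deriv f ^ 2 - (1 - 2 * d * f ^ 2 + e * f ^ 4)) = 0"
      using DE[of f] by simp
    then have "fps_deriv f ^ 2 - (1 - 2 * d * f ^ 2 + e * f ^ 4) =
      fps_const (fps_nth (fps_deriv f ^ 2 - (1 - 2 * d * f ^ 2 + e * f ^ 4)) 0)"
      by (simp only: fps_deriv_eq_0_iff)
    also have "fps_nth (fps_deriv f ^ 2 - (1 - 2 * d * f ^ 2 + e * f ^ 4)) 0 = 0"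
      using f0 f1 by (simp add: fps_power_zeroth)
    finally show "?P f" using f0 f1 by (simp add: d_def e_def)
  qed
  obtain g where g: "\<forall>n. fps_nth g n = \<Phi> n (fps_cutoff n g)"
    using fps_cutoff_rec[of \<Phi>] by blast
  show ?thesis
  proof (rule ex1I)
    show "?P g" using g * by blast
  next
    fix h assume "?P h"
    then have "\<forall>n. fps_nth h n = \<Phi> n (fps_cutoff n h)" using * by blast
    then show "h = g" using g by (intro fps_eqI_cutoff) metis
  qed
qed

lemma ell_f:
  "fps_nth ell_f 0 = 0" "fps_nth ell_f 1 = 1"
  "fps_deriv ell_f ^ 2 = 1 - 2 * fps_const ell_delta * ell_f ^ 2 + fps_const ell_eps * ell_f ^ 4"
  using theI'[OF ell_f_ex1] by (simp_all add: ell_f_def)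

lemma ell_pow_nth: "fps_nth (ell_pow s) 0 = 0" "fps_nth (ell_pow s) 1 = of_int s"
proof -
  show "fps_nth (ell_pow s) 0 = 0" using ell_f by (simp add: ell_pow_def)
  show "fps_nth (ell_pow s) 1 = of_int s"
    using ell_f fps_comp_inv[of ell_f]
    by (simp add: ell_pow_def fps_compose_nth fps_mult_nth_1 flip: fps_of_int)
qed

lemma ell_pow_quot:
  assumes "s \<noteq> 0"
  shows "fps_quot (c * fps_X) (ell_pow s) * ell_pow s = c * fps_X"
proof -
  define U where "U = fps_shift 1 (ell_pow s)"
  have XU: "ell_pow s = fps_X * U"
    using fps_cutoff_split[of "ell_pow s" 1] ell_pow_nth(1)[of s]
    by (simp add: U_def fps_eq_iff)
  have inv: "fps_nth U 0 * [:[:1 / of_int s:]:] = 1"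
    using assms ell_pow_nth(2)[of s] by (simp add: U_def of_int_poly one_pCons)
  define V where "V = fps_right_inverse U [:[:1 / of_int s:]:]"
  have UV: "U * V = 1" unfolding V_def by (rule fps_right_inverse[OF inv])
  have "c * V * ell_pow s = c * fps_X * (U * V)"
    by (simp only: XU mult_ac)
  then have "c * V * ell_pow s = c * fps_X" using UV by simp
  moreover have "ell_pow s \<noteq> 0"
    using ell_pow_nth(2)[of s] assms by auto
  ultimately show ?thesis using fps_quot_eqI by metis
qed

lemma fps_inv_sqrt_ex1:
  fixes D :: "'a::idom fps"
  assumes "2 * h = (1::'a)" "fps_nth D 0 = 1"
  shows "\<exists>!L. fps_nth L 0 = 1 \<and> L ^ 2 * D = 1"
proof -
  define \<Phi> where "\<Phi> = (\<lambda>n T. if n = 0 then 1 else - h * fps_nth (T ^ 2 * D) n)"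
  have cut: "fps_nth (L ^ 2 * D) n = fps_nth (fps_cutoff n L ^ 2 * D) n + 2 * fps_nth L n"
    if "n > 0" "fps_nth L 0 = 1" for n L
  proof -
    define T where "T = fps_cutoff n L"
    define S where "S = fps_shift n L"
    have L: "L = T + fps_X ^ n * S"
      unfolding T_def S_def by (rule fps_cutoff_split)
    have "L ^ 2 * D - T ^ 2 * D = fps_X ^ n * (S * (L + T) * D)"
      by (subst (1 2) L) (simp add: algebra_simps power2_eq_square)
    then have "fps_nth (L ^ 2 * D - T ^ 2 * D) n = fps_nth (S * (L + T) * D) 0"
      by (simp add: fps_X_power_mult_nth)
    also have "\<dots> = 2 * fps_nth L n"
      using that assms by (simp add: S_def T_def)
    finally show ?thesis by (simp add: T_def algebra_simps)
  qed
  have *: "fps_nth L 0 = 1 \<and> L ^ 2 * D = 1 \<longleftrightarrow> (\<forall>n. fps_nth L n = \<Phi> n (fps_cutoff n L))" for L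
  proof
    assume L: "fps_nth L 0 = 1 \<and> L ^ 2 * D = 1"
    show "\<forall>n. fps_nth L n = \<Phi> n (fps_cutoff n L)"
    proof
      fix n
      show "fps_nth L n = \<Phi> n (fps_cutoff n L)"
      proof (cases "n = 0")
        case False
        then have "fps_nth (fps_cutoff n L ^ 2 * D) n = - (2 * fps_nth L n)"
          using cut[of n L] L by (simp add: eq_neg_iff_add_eq_0)
        then have "\<Phi> n (fps_cutoff n L) = (2 * h) * fps_nth L n"
          using False by (simp add: \<Phi>_def)
        then show ?thesis by (simp only: assms) simp
      qed (use L in \<open>auto simp: \<Phi>_def\<close>)
    qed
  next
    assume L: "\<forall>n. fps_nth L n = \<Phi> n (fps_cutoff n L)"
    have L0: "fps_nth L 0 = 1" using L[rule_format, of 0] by (simp add: \<Phi>_def)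
    have "fps_nth (L ^ 2 * D) n = fps_nth 1 n" for n
    proof (cases "n = 0")
      case False
      have "2 * fps_nth L n = - ((2 * h) * fps_nth (fps_cutoff n L ^ 2 * D) n)"
        using False L[rule_format, of n] by (simp add: \<Phi>_def)
      also have "\<dots> = - fps_nth (fps_cutoff n L ^ 2 * D) n" by (simp only: assms) simp
      finally show ?thesis using cut[of n L] False L0 by simp
    qed (use L0 assms in \<open>auto simp: fps_power_zeroth\<close>)
    then show "fps_nth L 0 = 1 \<and> L ^ 2 * D = 1" using L0 by (auto intro: fps_ext)
  qed
  obtain g where g: "\<forall>n. fps_nth g n = \<Phi> n (fps_cutoff n g)"
    using fps_cutoff_rec[of \<Phi>] by blast
  show ?thesis
  proof (rule ex1I)
    show "fps_nth g 0 = 1 \<and> g ^ 2 * D = 1" using g * by blast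
  next
    fix h assume "fps_nth h 0 = 1 \<and> h ^ 2 * D = 1"
    then have "\<forall>n. fps_nth h n = \<Phi> n (fps_cutoff n h)" using * by blast
    then show "h = g" using g by (intro fps_eqI_cutoff) metis
  qed
qed

lemma legendre_series_ex1:
  "\<exists>!L :: rat poly fps. fps_nth L 0 = 1 \<and>
     L ^ 2 * (1 - 2 * fps_const [:0, 1:] * fps_X + fps_X ^ 2) = 1"
  by (rule fps_inv_sqrt_ex1[where h = "[:1/2:]"])
     (simp_all add: one_pCons numeral_poly fps_power_zeroth)

lemma legendre_series:
  "fps_nth legendre_series 0 = 1"
  "legendre_series ^ 2 * (1 - 2 * fps_const [:0, 1:] * fps_X + fps_X ^ 2) = 1"
  using theI'[OF legendre_series_ex1] by (simp_all add: legendre_series_def)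

lemma map_poly_hom_add:
  assumes "\<And>a b. \<phi> (a + b) = \<phi> a + \<phi> b" "\<phi> 0 = 0"
  shows "map_poly \<phi> (A + B) = map_poly \<phi> A + map_poly \<phi> B"
  using assms by (intro poly_eqI) (simp add: coeff_map_poly)

lemma hom_sum:
  assumes "\<And>a b. \<phi> (a + b) = \<phi> a + \<phi> b" "\<phi> 0 = 0"
  shows "\<phi> (sum g A) = (\<Sum>x\<in>A. \<phi> (g x))"
  by (induction A rule: infinite_finite_induct) (simp_all add: assms)

lemma map_poly_hom_mult:
  fixes \<phi> :: "'a::comm_semiring_0 \<Rightarrow> 'b::comm_semiring_0"
  assumes "\<And>a b. \<phi> (a + b) = \<phi> a + \<phi> b" "\<phi> 0 = 0" "\<And>a b. \<phi> (a * b) = \<phi> a * \<phi> b"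
  shows "map_poly \<phi> (A * B) = map_poly \<phi> A * map_poly \<phi> B"
  using assms by (intro poly_eqI) (simp add: coeff_map_poly coeff_mult hom_sum[of \<phi>])

lemma fps_hom_mult:
  fixes \<phi> :: "'a::comm_semiring_0 \<Rightarrow> 'b::comm_semiring_0"
  assumes "\<And>a b. \<phi> (a + b) = \<phi> a + \<phi> b" "\<phi> 0 = 0" "\<And>a b. \<phi> (a * b) = \<phi> a * \<phi> b"
  shows "Abs_fps (\<lambda>n. \<phi> (fps_nth (A * B) n)) =
    Abs_fps (\<lambda>n. \<phi> (fps_nth A n)) * Abs_fps (\<lambda>n. \<phi> (fps_nth B n))"
  using assms by (intro fps_ext) (simp add: fps_mult_nth hom_sum[of \<phi>])

lemma fps_scale_mult:
  fixes k :: "'a::comm_semiring_1"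
  shows "Abs_fps (\<lambda>n. k ^ n * fps_nth (A * B) n) =
    Abs_fps (\<lambda>n. k ^ n * fps_nth A n) * Abs_fps (\<lambda>n. k ^ n * fps_nth B n)"
proof (intro fps_ext)
  fix n
  have "k ^ n * (fps_nth A i * fps_nth B (n - i)) =
     k ^ i * fps_nth A i * (k ^ (n - i) * fps_nth B (n - i))" if "i \<in> {0..n}" for i
  proof -
    have "i + (n - i) = n" using that by simp
    then have "k ^ n = k ^ i * k ^ (n - i)" using power_add[of k i "n - i"] by (simp only:)
    then show ?thesis by (simp only: mult_ac)
  qed
  then show "fps_nth (Abs_fps (\<lambda>n. k ^ n * fps_nth (A * B) n)) n =
    fps_nth (Abs_fps (\<lambda>n. k ^ n * fps_nth A n) * Abs_fps (\<lambda>n. k ^ n * fps_nth B n)) n"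
    unfolding fps_mult_nth fps_nth_Abs_fps sum_distrib_left by (rule sum.cong[OF refl])
qed

lemma fps_quadratic_nth:
  fixes a b :: "'a::comm_ring_1"
  shows "fps_nth (1 - fps_const a * fps_X + fps_const b * fps_X ^ 2) n =
    (if n = 0 then 1 else if n = 1 then - a else if n = 2 then b else 0)"
  by (simp add: fps_X_power_nth)

lemma inj_eps_to_k2: "eps_to_k2 R = eps_to_k2 S \<longleftrightarrow> R = S"
proof -
  have "[:0, 1:] \<noteq> (0 :: rat poly poly)" by simp
  then have "degree ([:0, 1:] ^ 2 :: rat poly poly) = 2 * degree [:0, 1 :: rat poly:]"
    by (rule degree_power_eq)
  then have "degree ([:0, 1:] ^ 2 :: rat poly poly) > 0" by (simp only:) simp
  then have "pcompose (R - S) ([:0, 1:] ^ 2) = 0 \<longleftrightarrow> R - S = 0"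
    by (rule pcompose_eq_0_iff)
  then show ?thesis by (simp add: eps_to_k2_def pcompose_diff)
qed

text \<open>$k^m P_m(\delta/k)$ is the coefficient of $u^m$ in $(1-2\delta u+\varepsilon u^2)^{-1/2}$,
  which is the coefficient of $u^{2m}$ in $(1-2\delta u^2+\varepsilon u^4)^{-1/2}$.\<close>

lemma legendre_hom_aux:
  fixes M :: "rat poly poly fps"
  assumes M0: "fps_nth M 0 = 1"
    and M: "M ^ 2 * (1 - 2 * fps_const ell_delta * fps_X + fps_const ell_eps * fps_X ^ 2) = 1"
  shows "eps_to_k2 (fps_nth M m) =
      frac_k ^ m * poly (map_poly rat_to_frac (legendre_poly m)) (frac_delta / frac_k)"
proof -
  define E where "E = (1 - 2 * fps_const ell_delta * fps_X + fps_const ell_eps * fps_X ^ 2)"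
  define D where "D = (1 - 2 * fps_const [:0, 1 :: rat:] * fps_X + fps_X ^ 2)"
  define \<psi> where "\<psi> = (\<lambda>P. poly (map_poly rat_to_frac P) (frac_delta / frac_k))"
  have k0: "frac_k \<noteq> 0" by (simp add: frac_k_def)
  have \<phi>: "eps_to_k2 (a + b) = eps_to_k2 a + eps_to_k2 b" "eps_to_k2 0 = 0" "eps_to_k2 1 = 1"
    "eps_to_k2 (a * b) = eps_to_k2 a * eps_to_k2 b" "eps_to_k2 (- a) = - eps_to_k2 a" for a b
    unfolding eps_to_k2_def
    by (simp_all only: pcompose_add pcompose_mult pcompose_1 pcompose_uminus pcompose_0
        to_fract_add to_fract_mult to_fract_uminus to_fract_0 to_fract_1)
  have c: "rat_to_frac (a + b) = rat_to_frac a + rat_to_frac b" "rat_to_frac 0 = 0"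
    "rat_to_frac 1 = 1" "rat_to_frac (a * b) = rat_to_frac a * rat_to_frac b"
    "rat_to_frac (- a) = - rat_to_frac a" for a b
    unfolding rat_to_frac_def to_fract_add[symmetric] to_fract_mult[symmetric]
      to_fract_uminus[symmetric] to_fract_eq_0_iff
    by (simp_all add: pCons_one)
  have \<psi>: "\<psi> (a + b) = \<psi> a + \<psi> b" "\<psi> 0 = 0" "\<psi> 1 = 1" "\<psi> (a * b) = \<psi> a * \<psi> b" for a b
    by (simp_all add: \<psi>_def map_poly_hom_add map_poly_hom_mult c)
  define M' where "M' = Abs_fps (\<lambda>n. eps_to_k2 (fps_nth M n))"
  define E' where "E' = Abs_fps (\<lambda>n. eps_to_k2 (fps_nth E n))"
  define L where "L = Abs_fps (\<lambda>n. \<psi> (fps_nth legendre_series n))"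
  define L' where "L' = Abs_fps (\<lambda>n. frac_k ^ n * fps_nth L n)"
  define D1 where "D1 = Abs_fps (\<lambda>n. \<psi> (fps_nth D n))"
  define D' where "D' = Abs_fps (\<lambda>n. frac_k ^ n * fps_nth D1 n)"
  have "M' * M' * E' = Abs_fps (\<lambda>n. eps_to_k2 (fps_nth (M * M * E) n))"
    unfolding M'_def E'_def by (simp add: fps_hom_mult \<phi>)
  also have "M * M * E = 1" using M by (simp add: E_def power2_eq_square)
  finally have 1: "M' * M' * E' = 1" by (simp add: fps_eq_iff \<phi>)
  have "L * L * D1 = Abs_fps (\<lambda>n. \<psi> (fps_nth (legendre_series * legendre_series * D) n))"
    unfolding L_def D1_def by (simp add: fps_hom_mult \<psi>)
  also have "legendre_series * legendre_series * D = 1"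
    using legendre_series by (simp add: D_def power2_eq_square)
  finally have "L * L * D1 = 1" by (simp add: fps_eq_iff \<psi>)
  moreover have "L' * L' * D' = Abs_fps (\<lambda>n. frac_k ^ n * fps_nth (L * L * D1) n)"
    unfolding L'_def D'_def by (simp add: fps_scale_mult)
  ultimately have 2: "L' * L' * D' = 1" by (simp add: fps_eq_iff)
  have "E = 1 - fps_const (ell_delta + ell_delta) * fps_X + fps_const ell_eps * fps_X ^ 2"
    by (simp only: E_def mult_2 fps_const_add)
  note En = fps_quadratic_nth[of "ell_delta + ell_delta" ell_eps, folded this]
  have "D = 1 - fps_const ([:0, 1:] + [:0, 1:]) * fps_X + fps_const 1 * fps_X ^ 2"
    by (simp only: D_def mult_2 fps_const_add fps_const_1_eq_1 mult_1_left)
  note Dn = fps_quadratic_nth[of "[:0, 1:] + [:0, 1:] :: rat poly" 1, folded this]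
  have \<phi>_eps: "eps_to_k2 ell_eps = frac_k ^ 2"
  proof -
    have "pcompose ell_eps ([:0, 1:] ^ 2) = [:0, 1:] * [:0, 1:]"
      by (simp only: ell_eps_def pcompose_pCons pcompose_const power2_eq_square pcompose_0) simp
    then show ?thesis
      by (simp only: eps_to_k2_def frac_k_def power2_eq_square to_fract_mult)
  qed
  have \<phi>_delta: "eps_to_k2 ell_delta = frac_delta"
    by (simp only: eps_to_k2_def ell_delta_def frac_delta_def pcompose_const)
  have \<psi>_delta: "\<psi> [:0, 1:] = frac_delta / frac_k"
  proof -
    have "map_poly rat_to_frac [:0, 1:] = [:0, 1:]"
      by (simp only: map_poly_pCons[of rat_to_frac, OF c(2)] c map_poly_0)
    then show ?thesis unfolding \<psi>_def by (simp only:) simp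
  qed
  have \<psi>_minus: "\<psi> (- a) = - \<psi> a" for a
    using \<psi>(1)[of "- a" a] \<psi>(2) by (simp add: eq_neg_iff_add_eq_0)
  have "eps_to_k2 (fps_nth E n) = frac_k ^ n * \<psi> (fps_nth D n)" for n
  proof -
    consider "n = 0" | "n = 1" | "n = 2" | "n > 2" by linarith
    then show ?thesis
    proof cases
      case 1
      then have "fps_nth E n = 1" "fps_nth D n = 1" by (simp_all only: En Dn refl if_True)
      then show ?thesis using 1 by (simp only: \<phi> \<psi>) simp
    next
      case 2
      then have "fps_nth E n = - (ell_delta + ell_delta)" "fps_nth D n = - ([:0, 1:] + [:0, 1:])"
        by (simp_all only: En Dn one_neq_zero refl if_True if_False)
      then have "eps_to_k2 (fps_nth E n) = - (frac_delta + frac_delta)"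
        "\<psi> (fps_nth D n) = - (frac_delta / frac_k + frac_delta / frac_k)"
        by (simp_all only: \<phi> \<psi>(1) \<phi>_delta \<psi>_delta \<psi>_minus)
      then show ?thesis using 2 k0 by (simp add: field_simps)
    next
      case 3
      then have "fps_nth E n = ell_eps" "fps_nth D n = 1" by (simp_all add: En Dn)
      then show ?thesis using 3 by (simp only: \<phi>_eps \<psi>(3) mult_1_right)
    next
      case 4
      then have "fps_nth E n = 0" "fps_nth D n = 0" by (simp_all add: En Dn)
      then show ?thesis by (simp only: \<phi>(2) \<psi>(2) mult_zero_right)
    qed
  qed
  then have "E' = D'" by (simp add: E'_def D'_def D1_def)
  then have M'L': "M' ^ 2 * D' = 1" "L' ^ 2 * D' = 1"
    using 1 2 by (simp_all add: power2_eq_square)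
  have half: "2 * to_fract [:[:1 / 2 :: rat:]:] = 1"
    unfolding mult_2 to_fract_add[symmetric] by (simp add: pCons_one)
  have "fps_nth D' 0 = 1" by (simp add: D'_def D1_def Dn \<psi>)
  moreover have "fps_nth M' 0 = 1" "fps_nth L' 0 = 1"
    using M0 legendre_series by (simp_all add: M'_def L'_def L_def \<phi> \<psi>)
  ultimately have "M' = L'" using fps_inv_sqrt_ex1[OF half, of D'] M'L' by blast
  then have "fps_nth M' m = fps_nth L' m" by simp
  then show ?thesis by (simp add: M'_def L'_def L_def \<psi>_def legendre_poly_def)
qed

lemma legendre_hom_ex1:
  "\<exists>!R. eps_to_k2 R =
     frac_k ^ m * poly (map_poly rat_to_frac (legendre_poly m)) (frac_delta / frac_k)"
proof -
  have "\<exists>!M. fps_nth M 0 = 1 \<and>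
    M ^ 2 * (1 - 2 * fps_const ell_delta * fps_X + fps_const ell_eps * fps_X ^ 2) = 1"
    by (rule fps_inv_sqrt_ex1[where h = "[:[:1/2:]:]"])
       (simp_all add: one_pCons numeral_poly fps_power_zeroth)
  then show ?thesis using legendre_hom_aux inj_eps_to_k2 by metis
qed

lemma legendre_hom_eqI:
  assumes "fps_nth M 0 = 1"
    and "M ^ 2 * (1 - 2 * fps_const ell_delta * fps_X + fps_const ell_eps * fps_X ^ 2) = 1"
  shows "legendre_hom m = fps_nth M m"
  unfolding legendre_hom_def
  by (rule the1_equality[OF legendre_hom_ex1]) (rule legendre_hom_aux[OF assms])

end

theory Submission
  imports Defs
begin

text \<open>The two sides are in fact equal over \<open>\<rat>\<close>.
  Put \<open>\<Phi> = x/f\<close> and \<open>n = 2m\<close>. In the coordinate \<open>x = f\<inverse>(u)\<close> the sum of the products becomes, up to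
  the factor \<open>(u/x)\<^sup>n\<close>, the localization formula for the equivariant elliptic genus of \<open>CP\<^sup>n\<close>,
  \<open>\<Sum>\<^sub>j \<Prod>\<^sub>i \<Phi>((y\<^sub>i - y\<^sub>j) x) / (y\<^sub>i - y\<^sub>j)\<close>. Its \<open>x\<^sup>k\<close>-coefficient is a divided difference, at the \<open>n + 1\<close>
  points \<open>y\<^sub>j\<close>, of a polynomial of degree at most \<open>k\<close>. So it vanishes for \<open>k < n\<close>, and for \<open>k = n\<close> it is
  a leading coefficient, equal to \<open>[x\<^sup>n] \<Phi>\<^sup>n\<^sup>+\<^sup>1\<close>. Hence \<open>pu/[u]\<^sub>p = 1 + \<cdots>\<close> contributes only its
  constant term. By Lagrange inversion \<open>[x\<^sup>n] \<Phi>\<^sup>n\<^sup>+\<^sup>1\<close> is the \<open>u\<^sup>n\<close>-coefficient of the derivative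
  \<open>(1 - 2\<delta>u\<^sup>2 + \<epsilon>u\<^sup>4)\<^sup>-\<^sup>1\<^sup>/\<^sup>2\<close> of \<open>f\<inverse>\<close>.\<close>

section \<open>Divided differences and the localization sum\<close>

text \<open>By Lagrange interpolation \<open>q\<close> equals \<open>L\<close>, since both have
  degree below the number of nodes; then compare top coefficients. The basis polynomials are built
  from factors \<open>z i - t\<close>, whence the sign. The weights \<open>w j\<close> stand for
  reciprocals, which an integral domain need not contain.\<close>

lemma divided_difference_eq_lead_coeff:
  fixes q :: "'a::idom poly" and z w :: "'b \<Rightarrow> 'a"
  assumes "finite A" "inj_on z A" "degree q < card A"
    and w: "\<And>j. j \<in> A \<Longrightarrow> w j * (\<Prod>i\<in>A - {j}. z i - z j) = 1"
  shows "(\<Sum>j\<in>A. w j * poly q (z j)) = (-1) ^ (card A - 1) * coeff q (card A - 1)"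
proof -
  define B where "B = (\<lambda>j. \<Prod>i\<in>A - {j}. [:z i, -1:])"
  define L where "L = (\<Sum>j\<in>A. smult (w j * poly q (z j)) (B j))"
  have degB: "degree (B j) = card A - 1" if "j \<in> A" for j
    using that assms(1) by (simp add: B_def degree_prod_eq_sum_degree)
  have B: "coeff (B j) (card A - 1) = (-1) ^ (card A - 1)" if "j \<in> A" for j
  proof -
    have "lead_coeff (B j) = (\<Prod>i\<in>A - {j}. -1)"
      unfolding B_def lead_coeff_prod by (rule prod.cong) auto
    then show ?thesis using degB[OF that] that assms(1) by simp
  qed
  have L_at: "poly L (z j) = poly q (z j)" if j: "j \<in> A" for j
  proof -
    have "poly (B i) (z j) = 0" if "i \<in> A" "i \<noteq> j" for i
      using that j assms(1) by (auto simp: B_def poly_prod)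
    then have "poly L (z j) = (\<Sum>i\<in>A. if i = j then w j * poly q (z j) * poly (B j) (z j) else 0)"
      unfolding L_def poly_sum by (intro sum.cong) auto
    also have "\<dots> = poly q (z j) * (w j * poly (B j) (z j))"
      using j assms(1) by simp
    also have "w j * poly (B j) (z j) = 1"
      using w[OF j] by (simp add: B_def poly_prod)
    finally show ?thesis by simp
  qed
  have card: "card (z ` A) = card A" by (rule card_image) fact
  have "degree L < card A"
  proof -
    have "degree L \<le> card A - 1"
      unfolding L_def by (intro degree_sum_le order.trans[OF degree_smult_le]) (simp_all add: assms degB)
    then show ?thesis using assms(3) by simp
  qed
  then have "L = q"
    using assms(3) L_at by (intro poly_eqI_degree[of "z ` A"]) (auto simp: card)
  then have "coeff q (card A - 1) = coeff L (card A - 1)" by simp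
  also have "\<dots> = (\<Sum>j\<in>A. w j * poly q (z j) * coeff (B j) (card A - 1))"
    by (simp add: L_def coeff_sum)
  also have "\<dots> = (-1) ^ (card A - 1) * (\<Sum>j\<in>A. w j * poly q (z j))"
    unfolding sum_distrib_left by (intro sum.cong refl) (simp add: B del: One_nat_def)
  finally have "(-1) ^ (card A - 1) * coeff q (card A - 1) =
      ((-1) * (-1)) ^ (card A - 1) * (\<Sum>j\<in>A. w j * poly q (z j))"
    by (simp only: power_mult_distrib mult.assoc)
  then show ?thesis by simp
qed

lemma coeff_mult_le:
  fixes a b :: "'a::comm_semiring_0 poly"
  assumes "degree a \<le> i" "degree b \<le> j"
  shows "coeff (a * b) (i + j) = coeff a i * coeff b j"
proof -
  have "coeff a t * coeff b (i + j - t) = 0" if "t \<noteq> i" "t \<le> i + j" for t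
  proof (cases "t < i")
    case True
    then have "degree b < i + j - t" using assms by simp
    then show ?thesis by (simp add: coeff_eq_0)
  next
    case False
    then have "degree a < t" using that assms by simp
    then show ?thesis by (simp add: coeff_eq_0)
  qed
  then have "coeff (a * b) (i + j) = (\<Sum>t\<le>i + j. if t = i then coeff a i * coeff b j else 0)"
    unfolding coeff_mult by (intro sum.cong) auto
  then show ?thesis by simp
qed

text \<open>The bound \<open>degree \<le> k\<close> on the \<open>k\<close>-th coefficient is a
  filtration compatible with products, and the top coefficients are its symbol: in a product only
  top times top reaches degree \<open>k\<close>.\<close>

lemma fps_poly_mult_top_coeffs:
  fixes A B :: "'a::comm_ring_1 poly fps"
  assumes "\<And>k. degree (fps_nth A k) \<le> k" "\<And>k. degree (fps_nth B k) \<le> k"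
  shows "degree (fps_nth (A * B) k) \<le> k"
    "coeff (fps_nth (A * B) k) k =
      fps_nth (Abs_fps (\<lambda>k. coeff (fps_nth A k) k) * Abs_fps (\<lambda>k. coeff (fps_nth B k) k)) k"
proof -
  show "degree (fps_nth (A * B) k) \<le> k"
    unfolding fps_mult_nth
  proof (intro degree_sum_le)
    fix i assume "i \<in> {0..k}"
    then have "degree (fps_nth A i) + degree (fps_nth B (k - i)) \<le> k"
      using assms(1)[of i] assms(2)[of "k - i"] by simp
    then show "degree (fps_nth A i * fps_nth B (k - i)) \<le> k"
      using degree_mult_le order.trans by blast
  qed simp
  have "coeff (fps_nth A i * fps_nth B (k - i)) k =
      coeff (fps_nth A i) i * coeff (fps_nth B (k - i)) (k - i)" if "i \<in> {0..k}" for i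
    using coeff_mult_le[OF assms, of i "k - i"] that by simp
  then show "coeff (fps_nth (A * B) k) k =
      fps_nth (Abs_fps (\<lambda>k. coeff (fps_nth A k) k) * Abs_fps (\<lambda>k. coeff (fps_nth B k) k)) k"
    by (simp add: fps_mult_nth coeff_sum)
qed

text \<open>Turns the summation index into a variable: expanding \<Phi>((z_i - t) x) in x gives
  coefficients polynomial in t, so the summands for different \<open>j\<close> become values of one
  polynomial \<open>Q k\<close> at \<open>z j\<close>. In top degree in t each factor acts as
  \<Phi>(-t x).\<close>

lemma prod_shifted_scalings:
  fixes \<Phi> :: "'a::idom fps" and z :: "'b \<Rightarrow> 'a"
  assumes "finite A"
  obtains Q :: "nat \<Rightarrow> 'a poly"
  where "\<And>k. degree (Q k) \<le> k" "\<And>k. coeff (Q k) k = (-1) ^ k * fps_nth (\<Phi> ^ card A) k"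
    "\<And>k t. poly (Q k) t = fps_nth (\<Prod>i\<in>A. \<Phi> oo (fps_const (z i - t) * fps_X)) k"
proof -
  define F where "F = (\<lambda>i. Abs_fps (\<lambda>k. smult (fps_nth \<Phi> k) ([:z i, -1:] ^ k)))"
  define Q where "Q = (\<Prod>i\<in>A. F i)"
  have degF: "degree (fps_nth (F i) k) \<le> k" for i k
    by (simp add: F_def degree_power_eq)
  have lcF: "coeff (fps_nth (F i) k) k = (-1) ^ k * fps_nth \<Phi> k" for i k
  proof -
    have "lead_coeff ([:z i, -1:] ^ k) = (-1) ^ k" by (simp add: lead_coeff_power)
    then show ?thesis by (simp add: F_def degree_power_eq mult.commute)
  qed
  have top: "(\<forall>k. degree (fps_nth Q k) \<le> k) \<and>
      (\<forall>k. coeff (fps_nth Q k) k = (-1) ^ k * fps_nth (\<Phi> ^ card A) k)"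
    unfolding Q_def using assms
  proof (induction A)
    case empty
    show ?case by auto
  next
    case (insert x A)
    note top = fps_poly_mult_top_coeffs[of "F x" "\<Prod>i\<in>A. F i", OF degF]
    \<comment> \<open>The signs amount to substituting -x for x, which is multiplicative.\<close>
    have "coeff (fps_nth (F x * (\<Prod>i\<in>A. F i)) k) k = (-1) ^ k * fps_nth (\<Phi> * \<Phi> ^ card A) k" for k
      using insert.IH fps_scale_mult[of "-1" \<Phi> "\<Phi> ^ card A"]
      by (subst top(2)) (simp_all add: lcF fps_eq_iff)
    then show ?case using insert top(1) by simp
  qed
  have eval: "Abs_fps (\<lambda>k. poly (fps_nth Q k) t) = (\<Prod>i\<in>A. \<Phi> oo (fps_const (z i - t) * fps_X))" for t
    unfolding Q_def using assms
  proof (induction A)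
    case empty
    show ?case by (simp add: fps_eq_iff)
  next
    case (insert x A)
    have "Abs_fps (\<lambda>k. poly (fps_nth (F x) k) t) = \<Phi> oo (fps_const (z x - t) * fps_X)"
      by (simp add: fps_eq_iff F_def)
    then show ?case
      using insert fps_hom_mult[of "\<lambda>q. poly q t" "F x" "\<Prod>i\<in>A. F i"] by simp
  qed
  show thesis
    by (rule that[of "fps_nth Q"]) (use top in \<open>auto simp flip: eval\<close>)
qed

lemma fixed_point_sum:
  fixes \<Phi> :: "'a::idom fps" and z w :: "'b \<Rightarrow> 'a"
  assumes "fps_nth \<Phi> 0 = 1" "finite A" "inj_on z A" "card A = Suc n" "k \<le> n"
    and w: "\<And>j. j \<in> A \<Longrightarrow> w j * (\<Prod>i\<in>A - {j}. z i - z j) = 1"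
  shows "fps_nth (\<Sum>j\<in>A. fps_const (w j) *
      (\<Prod>i\<in>A - {j}. \<Phi> oo (fps_const (z i - z j) * fps_X))) k =
    (if k = n then fps_nth (\<Phi> ^ Suc n) n else 0)"
proof -
  define \<Psi> where "\<Psi> = (\<lambda>i j. \<Phi> oo (fps_const (z i - z j) * fps_X))"
  obtain Q where Q: "\<And>k. degree (Q k) \<le> k"
    "\<And>k. coeff (Q k) k = (-1) ^ k * fps_nth (\<Phi> ^ card A) k"
    "\<And>k t. poly (Q k) t = fps_nth (\<Prod>i\<in>A. \<Phi> oo (fps_const (z i - t) * fps_X)) k"
    using prod_shifted_scalings[OF assms(2), of \<Phi> z] by blast
  \<comment> \<open>The factor with \<open>i = j\<close> is \<Phi>(0) = 1, so the product may run
    over all of \<open>A\<close>, independently of \<open>j\<close>.\<close>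
  have "\<Psi> j j = 1" for j
    using assms(1) by (simp add: \<Psi>_def)
  then have "(\<Prod>i\<in>A. \<Psi> i j) = (\<Prod>i\<in>A - {j}. \<Psi> i j)" if "j \<in> A" for j
    using prod.remove[OF assms(2) that, of "\<lambda>i. \<Psi> i j"] by simp
  then have "fps_nth (\<Sum>j\<in>A. fps_const (w j) * (\<Prod>i\<in>A - {j}. \<Psi> i j)) k =
      (\<Sum>j\<in>A. w j * poly (Q k) (z j))"
    unfolding fps_sum_nth by (intro sum.cong) (simp_all add: Q(3) \<Psi>_def)
  also have "\<dots> = (-1) ^ n * coeff (Q k) n"
    using divided_difference_eq_lead_coeff[OF assms(2,3) _ w, of "Q k"] Q(1)[of k] assms(4,5)
    by simp
  also have "\<dots> = (if k = n then fps_nth (\<Phi> ^ Suc n) n else 0)"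
  proof (cases "k = n")
    case True
    have "(-1) ^ n * ((-1) ^ n * fps_nth (\<Phi> ^ Suc n) n) =
        ((-1) * (-1)) ^ n * fps_nth (\<Phi> ^ Suc n) n"
      by (simp only: power_mult_distrib mult.assoc)
    then show ?thesis using True by (simp add: Q(2) assms(4))
  next
    case False
    then have "degree (Q k) < n" using Q(1)[of k] assms(5) by simp
    then show ?thesis using False by (simp add: coeff_eq_0)
  qed
  finally show ?thesis by (simp only: \<Psi>_def)
qed

section \<open>Residues and Lagrange inversion\<close>

text \<open>With \<open>\<Phi> = x/f\<close> this says that \<open>f'/f\<^sup>l\<^sup>+\<^sup>1\<close> has no residue for \<open>l > 0\<close>, being the
  derivative of \<open>-1/(l f\<^sup>l)\<close>.\<close>

lemma residue_power_quotient:
  fixes f \<Phi> :: "'a::{idom,ring_char_0} fps"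
  assumes \<Phi>: "\<Phi> * f = fps_X" "fps_nth \<Phi> 0 = 1" and f1: "fps_nth f 1 = 1"
  shows "fps_nth (\<Phi> ^ Suc l * fps_deriv f) l = (if l = 0 then 1 else 0)"
proof (cases l)
  case 0
  then show ?thesis using assms by simp
next
  case (Suc i)
  have "fps_deriv (\<Phi> * f) = 1" by (simp add: \<Phi>)
  then have *: "\<Phi> * fps_deriv f = 1 - fps_deriv \<Phi> * f" by (simp add: algebra_simps)
  have "\<Phi> ^ Suc l * fps_deriv f = \<Phi> ^ l * (\<Phi> * fps_deriv f)"
    by (simp add: algebra_simps)
  also have "\<dots> = \<Phi> ^ l - (\<Phi> * f) * (\<Phi> ^ i * fps_deriv \<Phi>)"
    unfolding * Suc by (simp add: algebra_simps)
  finally have "\<Phi> ^ Suc l * fps_deriv f = \<Phi> ^ l - fps_X * (\<Phi> ^ i * fps_deriv \<Phi>)"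
    by (simp only: \<Phi>)
  \<comment> \<open>The factor \<open>l = Suc i\<close> turns \<Phi>^i \<Phi>' into the derivative
    of \<Phi>^l; characteristic zero allows cancelling it at the end.\<close>
  then have "of_nat l * fps_nth (\<Phi> ^ Suc l * fps_deriv f) l =
      of_nat l * fps_nth (\<Phi> ^ l) l - of_nat l * fps_nth (\<Phi> ^ i * fps_deriv \<Phi>) i"
    by (simp add: Suc right_diff_distrib del: of_nat_Suc power_Suc)
  also have "of_nat l * fps_nth (\<Phi> ^ i * fps_deriv \<Phi>) i = fps_nth (fps_deriv (\<Phi> ^ l)) i"
  proof -
    have "fps_deriv (\<Phi> ^ l) = fps_const (of_nat l) * (\<Phi> ^ i * fps_deriv \<Phi>)"
      using fps_deriv_power'[of \<Phi> l]
      by (simp add: Suc fps_of_nat mult_ac del: of_nat_Suc power_Suc)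
    then show ?thesis by simp
  qed
  also have "\<dots> = of_nat l * fps_nth (\<Phi> ^ l) l"
    by (simp add: Suc del: power_Suc)
  finally have "of_nat l * fps_nth (\<Phi> ^ Suc l * fps_deriv f) l = 0" by simp
  then show ?thesis by (simp add: Suc del: of_nat_Suc power_Suc)
qed

text \<open>\<open>W\<close> is the derivative of the compositional inverse of \<open>f\<close>,
  characterized by the chain rule. When W(f) is expanded in powers of \<open>f\<close>, the power
  f^k absorbs \<open>k\<close> of the factors \<Phi>, and by \<open>residue_power_quotient\<close>
  only the term \<open>k = n\<close> survives.\<close>

lemma lagrange_inversion_deriv:
  fixes f \<Phi> W :: "'a::{idom,ring_char_0} fps"
  assumes \<Phi>: "\<Phi> * f = fps_X" "fps_nth \<Phi> 0 = 1" and f: "fps_nth f 0 = 0" "fps_nth f 1 = 1"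
    and W: "(W oo f) * fps_deriv f = 1"
  shows "fps_nth (\<Phi> ^ Suc n) n = fps_nth W n"
proof -
  \<comment> \<open>The tail of \<open>W\<close> beyond degree \<open>n\<close> picks up the factor
    X^(n+1) and cannot reach the coefficient of degree \<open>n\<close>.\<close>
  define S where "S = fps_shift (Suc n) W"
  have "fps_cutoff (Suc n) W = (\<Sum>k\<le>n. fps_const (fps_nth W k) * fps_X ^ k)"
    by (simp add: fps_eq_iff fps_sum_nth if_distrib cong: if_cong)
  then have "W = (\<Sum>k\<le>n. fps_const (fps_nth W k) * fps_X ^ k) + fps_X ^ Suc n * S"
    using fps_cutoff_split[of W "Suc n"] by (simp only: S_def)
  then have "W oo f = (\<Sum>k\<le>n. fps_const (fps_nth W k) * fps_X ^ k) + fps_X ^ Suc n * S oo f"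
    by (rule arg_cong)
  then have Wf: "W oo f = (\<Sum>k\<le>n. fps_const (fps_nth W k) * f ^ k) + f ^ Suc n * (S oo f)"
    by (simp only: fps_compose_add_distrib fps_compose_sum_distrib fps_compose_mult_distrib[OF f(1)]
        fps_X_power_compose[OF f(1)] fps_const_compose)
  have pow: "\<Phi> ^ Suc n * f ^ k = fps_X ^ k * \<Phi> ^ Suc (n - k)" if "k \<le> n" for k
  proof -
    have "\<Phi> ^ Suc n = \<Phi> ^ (k + Suc (n - k))" using that by simp
    also have "\<dots> * f ^ k = (\<Phi> * f) ^ k * \<Phi> ^ Suc (n - k)"
      by (simp only: power_add power_mult_distrib mult_ac)
    finally show ?thesis by (simp only: \<Phi>)
  qed
  have "\<Phi> ^ Suc n = \<Phi> ^ Suc n * ((W oo f) * fps_deriv f)" by (simp only: W mult_1_right)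
  also have "\<dots> = (\<Sum>k\<le>n. fps_const (fps_nth W k) * ((\<Phi> ^ Suc n * f ^ k) * fps_deriv f))
      + (\<Phi> * f) ^ Suc n * ((S oo f) * fps_deriv f)"
    unfolding Wf power_mult_distrib
    by (simp only: distrib_left distrib_right sum_distrib_left sum_distrib_right mult_ac)
  also have "\<dots> = (\<Sum>k\<le>n. fps_const (fps_nth W k) * (fps_X ^ k * (\<Phi> ^ Suc (n - k) * fps_deriv f)))
      + fps_X ^ Suc n * ((S oo f) * fps_deriv f)"
    unfolding \<Phi> by (intro arg_cong2[where f = "(+)"] sum.cong refl) (simp only: pow mult.assoc atMost_iff)
  finally have "fps_nth (\<Phi> ^ Suc n) n =
      (\<Sum>k\<le>n. fps_nth W k * fps_nth (\<Phi> ^ Suc (n - k) * fps_deriv f) (n - k))"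
    by (simp only: fps_add_nth fps_sum_nth fps_mult_left_const_nth fps_X_power_mult_nth) simp
  also have "\<dots> = (\<Sum>k\<le>n. if k = n then fps_nth W n else 0)"
    by (intro sum.cong refl) (simp only: residue_power_quotient[OF \<Phi> f(2)], auto)
  finally show ?thesis by simp
qed

section \<open>The elliptic formal group and the Legendre polynomials\<close>

lemma fps_const_prod:
  fixes c :: "'b \<Rightarrow> 'a::comm_ring_1"
  shows "(\<Prod>i\<in>A. fps_const (c i)) = fps_const (\<Prod>i\<in>A. c i)"
  by (induction A rule: infinite_finite_induct) simp_all

lemma fps_X_quotient:
  fixes f :: "'a::comm_ring_1 fps"
  assumes "fps_nth f 0 = 0" "fps_nth f 1 = 1"
  obtains \<Phi> where "\<Phi> * f = fps_X" "fps_nth \<Phi> 0 = 1"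
proof -
  define U where "U = fps_shift 1 f"
  have f: "f = fps_X * U"
    using fps_cutoff_split[of f 1] assms(1) by (simp add: U_def fps_eq_iff)
  have "U * fps_right_inverse U 1 = 1"
    using assms by (intro fps_right_inverse) (simp add: U_def)
  then have "fps_right_inverse U 1 * f = fps_X"
    unfolding f by (simp add: mult_ac)
  then show thesis by (rule that) simp
qed

text \<open>\<open>W\<close> is (1 - 2 \<delta> u^2 + \<epsilon> u^4)^(-1/2), obtained from the
  series \<open>M\<close> by replacing u with u^2. After substituting \<open>ell_f\<close> for u,
  the differential equation of \<open>ell_f\<close> says that the square of W(f) f' is 1.\<close>

lemma legendre_hom_inv_sqrt:
  obtains W where "fps_nth W 0 = 1" "(W oo ell_f) * fps_deriv ell_f = 1"
    "\<And>m. fps_nth W (2 * m) = legendre_hom m"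
proof -
  have "\<exists>!M. fps_nth M 0 = 1 \<and>
      M ^ 2 * (1 - 2 * fps_const ell_delta * fps_X + fps_const ell_eps * fps_X ^ 2) = 1"
    by (rule fps_inv_sqrt_ex1[where h = "[:[:1/2:]:]"])
       (simp_all add: one_pCons numeral_poly fps_power_zeroth)
  then obtain M where M: "fps_nth M 0 = 1"
    "M ^ 2 * (1 - 2 * fps_const ell_delta * fps_X + fps_const ell_eps * fps_X ^ 2) = 1"
    by blast
  define W where "W = M oo fps_X ^ 2"
  have W: "fps_nth W (2 * m) = fps_nth M m" for m
  proof -
    have "fps_nth W (2 * m) = (\<Sum>i\<in>{0..2 * m}. if i = m then fps_nth M m else 0)"
      unfolding W_def fps_compose_nth
      by (intro sum.cong refl) (auto simp: fps_X_power_nth simp flip: power_mult)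
    then show ?thesis by simp
  qed
  define N where "N = M oo ell_f ^ 2"
  have "(fps_X ^ 2 :: rat poly poly fps) oo ell_f = ell_f ^ 2"
    by (rule fps_X_power_compose) (rule ell_f)
  then have N: "W oo ell_f = N"
    unfolding W_def N_def using ell_f by (subst fps_compose_assoc[symmetric]) simp_all
  have c0: "fps_nth (ell_f ^ 2) 0 = 0" using ell_f by (simp add: fps_power_zeroth)
  have two: "(2 :: rat poly poly fps) = fps_const 2" by (simp add: numeral_fps_const)
  have "1 = M ^ 2 * (1 - 2 * fps_const ell_delta * fps_X + fps_const ell_eps * fps_X ^ 2) oo ell_f ^ 2"
    by (simp only: M fps_compose_1)
  also have "\<dots> = N ^ 2 * (1 - 2 * fps_const ell_delta * ell_f ^ 2 + fps_const ell_eps * (ell_f ^ 2) ^ 2)"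
    by (simp only: N_def two fps_compose_mult_distrib[OF c0] fps_compose_add_distrib
        fps_compose_sub_distrib fps_const_compose fps_compose_1
        fps_X_power_compose[OF c0] fps_X_fps_compose_startby0[OF c0] fps_compose_power[OF c0])
  also have "\<dots> = (N * fps_deriv ell_f) ^ 2"
    by (simp add: ell_f(3) power_mult_distrib flip: power_mult)
  finally have "N * fps_deriv ell_f = 1 \<or> N * fps_deriv ell_f = -1"
    by (metis power2_eq_1_iff)
  \<comment> \<open>The constant term decides the sign of the square root.\<close>
  moreover have "fps_nth (N * fps_deriv ell_f) 0 = 1"
    using M ell_f by (simp add: N_def)
  ultimately have "N * fps_deriv ell_f = 1" by (auto simp: fps_eq_iff)
  then show thesis
    using that[of W] W W[of 0] M N legendre_hom_eqI[OF M] by simp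
qed

text \<open>With x = f^-1(u) one has u/[u]_s = (1/s) (u/x) (sx/f(sx)). Here \<open>r\<close> is 1/s,
  \<open>\<Gamma>\<close> is u/x as a series in u, and \<open>\<Phi>\<close> is x/f(x).\<close>

lemma ell_pow_quot_eq:
  fixes s :: int
  assumes \<Phi>: "\<Phi> * ell_f = fps_X" and \<Gamma>: "\<Gamma> * fps_comp_inv ell_f = fps_X"
    and r: "of_int s * r = (1 :: rat poly poly)"
  shows "fps_quot fps_X (ell_pow s) = fps_const r * \<Gamma> * (\<Phi> oo (of_int s * fps_X) oo fps_comp_inv ell_f)"
proof (rule fps_quot_eqI)
  define g where "g = fps_comp_inv ell_f"
  have g0: "fps_nth g 0 = 0" unfolding g_def using fps_comp_inv ell_f by blast
  have sg: "(of_int s * fps_X :: rat poly poly fps) oo g = of_int s * g"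
    by (simp add: fps_compose_mult_distrib[OF g0] g0 fps_of_int[symmetric] del: fps_of_int)
  have sg0: "fps_nth (of_int s * g) 0 = 0" using g0 by simp
  have "\<Phi> oo (of_int s * fps_X) oo g = \<Phi> oo (of_int s * g)"
    using fps_compose_assoc[OF g0, of "of_int s * fps_X" \<Phi>] by (simp add: sg)
  moreover have "(\<Phi> oo (of_int s * g)) * ell_pow s = of_int s * g"
    using fps_compose_mult_distrib[OF sg0, of \<Phi> ell_f] \<Phi> sg0 by (simp add: ell_pow_def g_def)
  ultimately have "fps_const r * \<Gamma> * (\<Phi> oo (of_int s * fps_X) oo g) * ell_pow s =
      fps_const r * \<Gamma> * (of_int s * g)"
    by (simp only: mult.assoc)
  also have "\<dots> = (fps_const (of_int s) * fps_const r) * (\<Gamma> * g)"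
    by (simp add: fps_of_int mult_ac)
  also have "\<dots> = fps_X" using \<Gamma> r by (simp add: g_def)
  finally show "fps_const r * \<Gamma> * (\<Phi> oo (of_int s * fps_X) oo fps_comp_inv ell_f) * ell_pow s = fps_X"
    by (simp add: g_def)
  show "ell_pow s \<noteq> 0"
    using ell_pow_nth(2)[of s] r by auto
qed

lemma ell_pow_quot_nth_0:
  assumes "n > 0"
  shows "fps_nth (fps_quot (of_nat n * fps_X) (ell_pow (int n))) 0 = 1"
proof -
  define h where "h = fps_quot (of_nat n * fps_X) (ell_pow (int n))"
  have "h * ell_pow (int n) = of_nat n * fps_X"
    unfolding h_def using assms by (intro ell_pow_quot) simp
  then have "fps_nth (h * ell_pow (int n)) 1 = of_nat n"
    by (simp flip: fps_of_nat)
  then have "fps_nth h 0 * of_nat n = of_nat n"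
    using ell_pow_nth[of "int n"] by (simp add: fps_mult_nth_1)
  then show ?thesis using assms by (simp add: h_def)
qed

section \<open>Evaluation of the elliptic sum\<close>

lemma elliptic_fixed_point_formula:
  fixes y :: "nat \<Rightarrow> int"
  assumes "p > 0" and inj: "inj_on y {0..2 * m}"
  shows "(\<Sum>j\<in>{0..2*m}. fps_nth
       (fps_quot (of_nat p * fps_X) (ell_pow (int p)) *
        (\<Prod>i\<in>{0..2*m} - {j}. fps_quot fps_X (ell_pow (y i - y j)))) (2 * m)) = legendre_hom m"
proof -
  define n where "n = 2 * m"
  define A where "A = {0..n}"
  define g where "g = fps_comp_inv ell_f"
  define H where "H = fps_quot (of_nat p * fps_X) (ell_pow (int p))"
  have g: "fps_nth g 0 = 0" "fps_nth g 1 = 1"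
    unfolding g_def using fps_comp_inv[OF ell_f(1,2)] by blast+
  obtain \<Phi> where \<Phi>: "\<Phi> * ell_f = fps_X" "fps_nth \<Phi> 0 = 1"
    using fps_X_quotient ell_f by metis
  obtain \<Gamma> where \<Gamma>: "\<Gamma> * g = fps_X" using fps_X_quotient g by metis
  obtain W where W: "(W oo ell_f) * fps_deriv ell_f = 1" "fps_nth W n = legendre_hom m"
    unfolding n_def using legendre_hom_inv_sqrt by metis
  define r :: "int \<Rightarrow> rat poly poly" where "r = (\<lambda>s. [:[:1 / of_int s:]:])"
  have r: "of_int s * r s = 1" if "s \<noteq> 0" for s
    using that by (simp add: r_def of_int_poly one_pCons)
  define z :: "nat \<Rightarrow> rat poly poly" where "z = (\<lambda>i. of_int (y i))"
  define w where "w = (\<lambda>j. \<Prod>i\<in>A - {j}. r (y i - y j))"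
  have neq: "y i - y j \<noteq> 0" if "j \<in> A" "i \<in> A - {j}" for i j
    using inj that by (auto simp: A_def n_def dest: inj_onD)
  have w: "w j * (\<Prod>i\<in>A - {j}. z i - z j) = 1" if "j \<in> A" for j
    unfolding w_def prod.distrib[symmetric]
  proof (intro prod.neutral ballI)
    fix i assume "i \<in> A - {j}"
    then show "r (y i - y j) * (z i - z j) = 1"
      using r[OF neq[OF that]] by (simp add: z_def mult.commute)
  qed
  define \<Psi> where "\<Psi> = (\<lambda>i j. \<Phi> oo (fps_const (z i - z j) * fps_X))"
  define S where "S = (\<Sum>j\<in>A. fps_const (w j) * (\<Prod>i\<in>A - {j}. \<Psi> i j))"
  have S: "fps_nth S k = (if k = n then fps_nth (\<Phi> ^ Suc n) n else 0)" if "k \<le> n" for k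
    unfolding S_def \<Psi>_def
  proof (rule fixed_point_sum[OF \<Phi>(2) _ _ _ that w])
    show "inj_on z A" using inj by (simp add: z_def A_def n_def inj_on_def)
  qed (simp_all add: A_def)
  define C where "C = fps_shift n S"
  have "fps_cutoff n S = 0" by (simp add: fps_eq_iff S)
  then have SC: "S = fps_X ^ n * C"
    using fps_cutoff_split[of S n] by (simp add: C_def)
  \<comment> \<open>Each of the \<open>n\<close> factors contributes one \<open>\<Gamma>\<close>;
    the power \<open>\<Gamma> ^ n\<close> is the same for all \<open>j\<close> and can leave the
    sum.\<close>
  have prod: "(\<Prod>i\<in>A - {j}. fps_quot fps_X (ell_pow (y i - y j))) =
      \<Gamma> ^ n * (fps_const (w j) * (\<Prod>i\<in>A - {j}. \<Psi> i j) oo g)" if j: "j \<in> A" for j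
  proof -
    have "fps_quot fps_X (ell_pow (y i - y j)) = fps_const (r (y i - y j)) * \<Gamma> * (\<Psi> i j oo g)"
      if "i \<in> A - {j}" for i
    proof -
      have "(of_int (y i - y j) :: rat poly poly fps) = fps_const (z i - z j)"
        by (simp add: z_def flip: fps_of_int)
      then show ?thesis
        using ell_pow_quot_eq[OF \<Phi>(1) \<Gamma>[unfolded g_def] r[OF neq[OF j that]]]
        by (simp only: \<Psi>_def g_def)
    qed
    then have "(\<Prod>i\<in>A - {j}. fps_quot fps_X (ell_pow (y i - y j))) =
        (\<Prod>i\<in>A - {j}. fps_const (r (y i - y j))) * \<Gamma> ^ card (A - {j}) * (\<Prod>i\<in>A - {j}. \<Psi> i j oo g)"
      by (simp add: prod.distrib)
    also have "(\<Prod>i\<in>A - {j}. fps_const (r (y i - y j))) = fps_const (w j)"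
      unfolding w_def by (rule fps_const_prod)
    also have "card (A - {j}) = n" using j by (simp add: A_def)
    finally show ?thesis
      by (simp add: fps_compose_mult_distrib[OF g(1)] fps_compose_prod_distrib[OF g(1)] mult_ac)
  qed
  have "(\<Sum>j\<in>A. H * (\<Prod>i\<in>A - {j}. fps_quot fps_X (ell_pow (y i - y j)))) = H * (\<Gamma> ^ n * (S oo g))"
    unfolding S_def fps_compose_sum_distrib sum_distrib_left by (intro sum.cong refl) (simp add: prod)
  \<comment> \<open>\<open>S\<close> vanishes to order \<open>n\<close>, and
    \<open>\<Gamma> * g = fps_X\<close> turns each x = g(u) into u. So only the constant terms of
    \<open>H\<close> and \<open>C\<close> contribute in degree \<open>n\<close>.\<close>
  also have "\<dots> = H * ((\<Gamma> * g) ^ n * (C oo g))"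
    by (simp add: SC fps_compose_mult_distrib[OF g(1)] fps_X_power_compose[OF g(1)]
        power_mult_distrib mult_ac)
  also have "\<dots> = fps_X ^ n * (H * (C oo g))" by (simp add: \<Gamma> mult_ac)
  finally have "(\<Sum>j\<in>A. fps_nth (H * (\<Prod>i\<in>A - {j}. fps_quot fps_X (ell_pow (y i - y j)))) n) =
      fps_nth H 0 * fps_nth C 0"
    by (simp add: fps_X_power_mult_nth flip: fps_sum_nth)
  also have "\<dots> = fps_nth (\<Phi> ^ Suc n) n"
    using ell_pow_quot_nth_0[OF assms(1)] S[of n] by (simp add: H_def C_def)
  also have "\<dots> = legendre_hom m"
    using lagrange_inversion_deriv[OF \<Phi> ell_f(1,2) W(1)] W(2) by simp
  finally show ?thesis by (simp add: H_def A_def n_def)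
qed

theorem mainTheorem5:
  fixes p m :: nat and y :: "nat \<Rightarrow> int"
  assumes "prime p" and "odd p" and "m \<ge> 1" and "2 * m < p"
    and "\<And>i j. i \<le> 2 * m \<Longrightarrow> j \<le> 2 * m \<Longrightarrow> i \<noteq> j \<Longrightarrow> \<not> [y i = y j] (mod int p)"
  shows "cong_pZp p
    (\<Sum>j\<in>{0..2*m}. fps_nth
       (fps_quot (of_nat p * fps_X) (ell_pow (int p)) *
        (\<Prod>i\<in>{0..2*m} - {j}. fps_quot fps_X (ell_pow (y i - y j)))) (2 * m))
    (legendre_hom m)"
proof -
  have "inj_on y {0..2 * m}"
    using assms(5) by (intro inj_onI) (metis atLeastAtMost_iff cong_refl)
  moreover have "p > 0" using assms(1) by (rule prime_gt_0_nat)
  \<comment> \<open>As the two sides agree exactly, \<open>D = 0\<close> witnesses the congruence;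
    its coefficients are 0/1, and \<open>p > 1\<close> does not divide 1.\<close>
  moreover have "p_integral p 0"
    unfolding p_integral_def using prime_gt_1_nat[OF assms(1)]
    by (intro exI[of _ 0] exI[of _ 1]) simp
  then have "cong_pZp p R R" for R
    unfolding cong_pZp_def by (intro exI[of _ 0]) simp
  ultimately show ?thesis by (simp only: elliptic_fixed_point_formula)
qed

end
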